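(* Let $G$ be a connected $r$-regular graph on $p$ vertices and let $L(G)$ be its line graph. If the smallest adjacency eigenvalue of $G$ is greater than or equal to $2-r$ and $L(G)$ satisfies property $(\dagger)$, then $$E_\epsilon(\overline{L(G)})=4p(r-2).$$
   Context: All graphs are finite, simple, undirected and connected. For a connected graph $H$ with vertices $v_1,\ldots,v_n$, $d(v_i,v_j)$ is the distance and $e(v_i)=\max_j d(v_i,v_j)$ the eccentricity. The eccentricity matrix $\epsilon(H)$ has $(i,j)$ entry $d(v_i,v_j)$ if $d(v_i,v_j)=\min\{e(v_i),e(v_j)\}$ and $0$ otherwise, and $E_\epsilon(H)$ is the sum of absolute values of the eigenvalues of $\epsilon(H)$. $\overline{H}$ denotes the complement of $H$. A graph $H$ satisfies property $(\dagger)$ if for any two adjacent vertices $u,v$ of $H$ there is a third vertex $w$ adjacent to neither $u$ nor $v$. *)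

theory Defs
  imports Complex_Main "Jordan_Normal_Form.Spectral_Radius"
begin

record 'a sgraph =
  verts :: "'a set"
  edges :: "'a set set"

definition simple_graph :: "'a sgraph \<Rightarrow> bool" where
  "simple_graph G \<longleftrightarrow> finite (verts G) \<and> (\<forall>e\<in>edges G. e \<subseteq> verts G \<and> card e = 2)"

definition adjacent :: "'a sgraph \<Rightarrow> 'a \<Rightarrow> 'a \<Rightarrow> bool" where
  "adjacent G u v \<longleftrightarrow> {u, v} \<in> edges G"

definition adj_rel :: "'a sgraph \<Rightarrow> ('a \<times> 'a) set" where
  "adj_rel G = {(u, v). adjacent G u v}"

definition connected_graph :: "'a sgraph \<Rightarrow> bool" where
  "connected_graph G \<longleftrightarrow> verts G \<noteq> {} \<and>
     (\<forall>u\<in>verts G. \<forall>v\<in>verts G. (u, v) \<in> (adj_rel G)\<^sup>*)"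

definition regular_graph :: "'a sgraph \<Rightarrow> nat \<Rightarrow> bool" where
  "regular_graph G r \<longleftrightarrow> (\<forall>v\<in>verts G. card {u \<in> verts G. adjacent G v u} = r)"

definition line_graph :: "'a sgraph \<Rightarrow> 'a set sgraph" where
  "line_graph G = \<lparr>verts = edges G,
     edges = {{e, f} |e f. e \<in> edges G \<and> f \<in> edges G \<and> e \<noteq> f \<and> e \<inter> f \<noteq> {}}\<rparr>"

definition complement_graph :: "'a sgraph \<Rightarrow> 'a sgraph" where
  "complement_graph G = \<lparr>verts = verts G,
     edges = {{u, v} |u v. u \<in> verts G \<and> v \<in> verts G \<and> u \<noteq> v \<and> \<not> adjacent G u v}\<rparr>"

definition property_dagger :: "'a sgraph \<Rightarrow> bool" where
  "property_dagger G \<longleftrightarrow> (\<forall>u\<in>verts G. \<forall>v\<in>verts G. adjacent G u v \<longrightarrow>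
     (\<exists>w\<in>verts G. w \<noteq> u \<and> w \<noteq> v \<and> \<not> adjacent G w u \<and> \<not> adjacent G w v))"

(* A pair lies in the n-th relational power iff it is joined by a walk of length n.
   The value is only meaningful for vertices in the same component. *)
definition gdist :: "'a sgraph \<Rightarrow> 'a \<Rightarrow> 'a \<Rightarrow> nat" where
  "gdist G u v = (LEAST n. (u, v) \<in> adj_rel G ^^ n)"

definition eccentricity :: "'a sgraph \<Rightarrow> 'a \<Rightarrow> nat" where
  "eccentricity G u = Max (gdist G u ` verts G)"

(* The matrices below are indexed by a labelling vs of the vertices: a list containing each
   vertex exactly once. *)
definition vertex_labelling :: "'a sgraph \<Rightarrow> 'a list \<Rightarrow> bool" where
  "vertex_labelling G vs \<longleftrightarrow> distinct vs \<and> set vs = verts G"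

definition adjacency_mat :: "'a sgraph \<Rightarrow> 'a list \<Rightarrow> real mat" where
  "adjacency_mat G vs = mat (length vs) (length vs)
     (\<lambda>(i, j). if adjacent G (vs ! i) (vs ! j) then 1 else 0)"

definition eccentricity_mat :: "'a sgraph \<Rightarrow> 'a list \<Rightarrow> real mat" where
  "eccentricity_mat G vs = mat (length vs) (length vs)
     (\<lambda>(i, j). if gdist G (vs ! i) (vs ! j)
                    = min (eccentricity G (vs ! i)) (eccentricity G (vs ! j))
               then real (gdist G (vs ! i) (vs ! j)) else 0)"

(* Meant for real symmetric matrices, all of whose eigenvalues are real. *)
definition smallest_eigenvalue :: "real mat \<Rightarrow> real" where
  "smallest_eigenvalue A = Min (spectrum A)"

(* Eigenvalues are taken over the complex numbers and counted with algebraic multiplicity. *)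
definition mat_energy :: "real mat \<Rightarrow> real" where
  "mat_energy A = (let B = map_mat complex_of_real A in
     \<Sum>z\<in>spectrum B. real (order z (char_poly B)) * cmod z)"

definition eccentricity_energy :: "'a sgraph \<Rightarrow> 'a list \<Rightarrow> real" where
  "eccentricity_energy G vs = mat_energy (eccentricity_mat G vs)"

end

(*
  Let B be the vertex-edge incidence matrix of G, with n vertices and m edges. Then
  B B^T = A(G) + r I and B^T B = A(L(G)) + 2 I, and these two products have the same spectrum up
  to the multiplicity of 0. As A(G) has trace 0, the bound on its eigenvalues forces r >= 2, so
  every edge of G meets another one. Hence property (dagger) makes the complement of L(G) a graph
  in which every vertex has eccentricity 2, so its eccentricity matrix is
  2 A(L(G)) = 2 B^T B - 4 I. Its eigenvalues are therefore 2 lambda + 2 r - 4, which is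
  nonnegative by hypothesis, for the n eigenvalues lambda of A(G), and -4 with multiplicity m - n.
  Since the lambda sum to 0 and 2 m = n r, the energy is n (2 r - 4) + 4 (m - n) = 4 n (r - 2).
*)

theory Submission
  imports Defs
begin

section \<open>Eigenvalues with multiplicity\<close>

text \<open>A multiset keeps algebraic multiplicities, so sums over the spectrum and comparisons of
  spectra become multiset identities.\<close>

definition eigs :: "complex mat \<Rightarrow> complex multiset" where
  "eigs A = proots (char_poly A)"

lemma proots_prod_list_linear:
  "proots (\<Prod>a\<leftarrow>as. [:- a, 1:]) = mset (as :: 'a :: idom list)"
proof (induction as)
  case (Cons a as)
  have "(\<Prod>a\<leftarrow>as. [:- a, 1:]) \<noteq> 0" by (auto simp: prod_list_zero_iff)
  hence "proots ([:- a, 1:] * (\<Prod>a\<leftarrow>as. [:- a, 1:])) = {#a#} + mset as"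
    using Cons by (subst proots_mult) auto
  thus ?case by simp
qed simp

lemma eigs_upper_triangular:
  assumes "A \<in> carrier_mat n n" "upper_triangular A"
  shows "eigs A = mset (diag_mat A)"
  unfolding eigs_def char_poly_upper_triangular[OF assms] by (rule proots_prod_list_linear)

lemma eigs_similar: "similar_mat A B \<Longrightarrow> eigs A = eigs B"
  unfolding eigs_def by (simp add: char_poly_similar)

text \<open>Over the complex numbers the characteristic polynomial splits, so Schur
  triangularisation applies and the diagonal of \<open>T\<close> lists the eigenvalues. The
  conjugating matrices are exposed so that other expressions in \<open>A\<close> can be
  triangularised by the same pair.\<close>

lemma schur_eigs:
  fixes A :: "complex mat"
  assumes A: "A \<in> carrier_mat n n"
  obtains T P Q where "T \<in> carrier_mat n n" "P \<in> carrier_mat n n" "Q \<in> carrier_mat n n"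
    "P * Q = 1\<^sub>m n" "Q * P = 1\<^sub>m n" "A = P * T * Q" "upper_triangular T"
    "eigs A = mset (diag_mat T)"
proof -
  obtain as where as: "char_poly A = (\<Prod>a\<leftarrow>as. [:- a, 1:])"
    using char_poly_factorized[OF A] by blast
  obtain T P Q where "schur_decomposition A as = (T, P, Q)"
    by (cases "schur_decomposition A as") auto
  from schur_decomposition[OF A as this]
  have sim: "similar_mat_wit A T P Q" and ut: "upper_triangular T" by auto
  note w = similar_mat_witD2[OF A sim]
  have "eigs A = mset (diag_mat T)"
    using eigs_similar[of A T] eigs_upper_triangular[of T n] sim ut w
    unfolding similar_mat_def by auto
  with that w ut show ?thesis by blast
qed

lemma size_eigs:
  assumes "A \<in> carrier_mat n n"
  shows "size (eigs A) = n"
  using degree_monic_char_poly[OF assms] by (simp add: eigs_def size_proots_complex)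

text \<open>The similarity that triangularises \<open>A\<close> fixes the identity matrix, hence
  also triangularises \<open>c A + d I\<close>; each diagonal entry \<open>a\<close> becomes
  \<open>c * a + d\<close>.\<close>

lemma eigs_affine:
  assumes A: "A \<in> carrier_mat n n"
  shows "eigs (c \<cdot>\<^sub>m A + d \<cdot>\<^sub>m 1\<^sub>m n) = image_mset (\<lambda>a. c * a + d) (eigs A)"
proof -
  obtain T P Q where T: "T \<in> carrier_mat n n" and P: "P \<in> carrier_mat n n"
    and Q: "Q \<in> carrier_mat n n" and PQ: "P * Q = 1\<^sub>m n" "Q * P = 1\<^sub>m n"
    and A_eq: "A = P * T * Q" and ut: "upper_triangular T" and e: "eigs A = mset (diag_mat T)"
    using schur_eigs[OF A] by metis
  let ?T = "c \<cdot>\<^sub>m T + d \<cdot>\<^sub>m 1\<^sub>m n"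
  have T': "?T \<in> carrier_mat n n" using T by auto
  have "P * ?T * Q = (c \<cdot>\<^sub>m (P * T) + d \<cdot>\<^sub>m P) * Q"
    using P T by (simp add: mult_add_distrib_mat[OF P, of _ n] mult_smult_distrib[OF P, of _ n])
  also have "\<dots> = c \<cdot>\<^sub>m A + d \<cdot>\<^sub>m 1\<^sub>m n"
    using P T Q PQ
    by (simp add: A_eq add_mult_distrib_mat[of _ n n _ Q n] mult_smult_assoc_mat[of _ n n Q n])
  finally have eq: "P * ?T * Q = c \<cdot>\<^sub>m A + d \<cdot>\<^sub>m 1\<^sub>m n" .
  have "similar_mat (c \<cdot>\<^sub>m A + d \<cdot>\<^sub>m 1\<^sub>m n) ?T"
    using A P Q T' by (intro similar_matI[OF _ PQ eq[symmetric]]) auto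
  hence "eigs (c \<cdot>\<^sub>m A + d \<cdot>\<^sub>m 1\<^sub>m n) = eigs ?T" by (rule eigs_similar)
  also have "\<dots> = mset (diag_mat ?T)"
    using T ut by (intro eigs_upper_triangular[OF T']) (auto simp: upper_triangular_def)
  also have "diag_mat ?T = map (\<lambda>a. c * a + d) (diag_mat T)"
    using T by (auto simp: diag_mat_def)
  finally show ?thesis by (simp add: e)
qed

section \<open>The trace as the sum of the eigenvalues\<close>

definition trace_mat :: "'a :: comm_monoid_add mat \<Rightarrow> 'a" where
  "trace_mat A = (\<Sum>i<dim_row A. A $$ (i, i))"

lemma trace_mat_mult_comm:
  fixes A :: "'a :: comm_semiring_0 mat"
  assumes "A \<in> carrier_mat n m" "B \<in> carrier_mat m n"
  shows "trace_mat (A * B) = trace_mat (B * A)"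
proof -
  have "trace_mat (A * B) = (\<Sum>i<n. \<Sum>j<m. A $$ (i, j) * B $$ (j, i))"
    using assms by (auto simp: trace_mat_def scalar_prod_def atLeast0LessThan)
  also have "\<dots> = (\<Sum>j<m. \<Sum>i<n. B $$ (j, i) * A $$ (i, j))"
    by (subst sum.swap) (simp add: mult.commute)
  also have "\<dots> = trace_mat (B * A)"
    using assms by (auto simp: trace_mat_def scalar_prod_def atLeast0LessThan)
  finally show ?thesis .
qed

text \<open>Cyclic invariance of the trace moves \<open>P\<close> past \<open>T * Q\<close>, where
  it cancels \<open>Q\<close>; what remains is the diagonal sum of the triangular form.\<close>

lemma sum_eigs:
  assumes A: "A \<in> carrier_mat n n"
  shows "sum_mset (eigs A) = trace_mat A"
proof -
  obtain T P Q where T: "T \<in> carrier_mat n n" and P: "P \<in> carrier_mat n n"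
    and Q: "Q \<in> carrier_mat n n" and PQ: "Q * P = 1\<^sub>m n"
    and A_eq: "A = P * T * Q" and e: "eigs A = mset (diag_mat T)"
    using schur_eigs[OF A] by metis
  have "trace_mat A = trace_mat (P * (T * Q))"
    using P T Q by (simp add: A_eq assoc_mult_mat[of _ n n])
  also have "\<dots> = trace_mat ((T * Q) * P)"
    using P T Q by (intro trace_mat_mult_comm) auto
  also have "(T * Q) * P = T"
    using P T Q PQ by (simp add: assoc_mult_mat[of _ n n])
  also have "trace_mat T = sum_mset (mset (diag_mat T))"
    unfolding sum_mset_sum_list
    by (auto simp: trace_mat_def diag_mat_def sum_list_sum_nth intro!: sum.cong)
  finally show ?thesis by (simp add: e)
qed

section \<open>The spectra of AB and BA\<close>

lemma char_poly_zero_mat: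
  "char_poly (0\<^sub>m n n) = ([:0, 1:] ^ n :: complex poly)"
proof -
  have "char_poly (0\<^sub>m n n :: complex mat) = (\<Prod>a\<leftarrow>diag_mat (0\<^sub>m n n). [:- a, 1:])"
    by (rule char_poly_upper_triangular[of _ n]) auto
  moreover have "diag_mat (0\<^sub>m n n) = replicate n (0::complex)"
    by (rule nth_equalityI) (auto simp: diag_mat_def)
  ultimately show ?thesis by (simp add: prod_list_replicate)
qed

lemma uminus_zero_mat: "- 0\<^sub>m n m = (0\<^sub>m n m :: 'a :: group_add mat)"
  by (rule eq_matI) auto

text \<open>Two block triangular matrices of size \<open>n + m\<close> are similar, one with
  diagonal blocks AB and 0, the other with 0 and BA. Padding both sides with zeros avoids a case
  distinction on which of \<open>n\<close> and \<open>m\<close> is larger.\<close>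

lemma eigs_mult_comm:
  assumes A: "A \<in> carrier_mat n m" and B: "B \<in> carrier_mat m n"
  shows "eigs (A * B) + replicate_mset m 0 = eigs (B * A) + replicate_mset n 0"
proof -
  \<comment> \<open>\<open>?S\<close> is block unipotent with inverse \<open>?R\<close>, and it is
    chosen so that \<open>?M * ?S = ?S * ?N\<close>.\<close>
  let ?M = "four_block_mat (A * B) (0\<^sub>m n m) B (0\<^sub>m m m)"
  let ?N = "four_block_mat (0\<^sub>m n n) (0\<^sub>m n m) B (B * A)"
  let ?S = "four_block_mat (1\<^sub>m n) A (0\<^sub>m m n) (1\<^sub>m m)"
  let ?R = "four_block_mat (1\<^sub>m n) (- A) (0\<^sub>m m n) (1\<^sub>m m)"
  have SR: "?S * ?R = 1\<^sub>m (n + m)"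
    using A by (subst mult_four_block_mat[of _ n n _ m _ m _ _ n _ m]) 
      (auto simp: uminus_zero_mat add_uminus_minus_mat[of _ n m])
  have RS: "?R * ?S = 1\<^sub>m (n + m)"
    using A by (subst mult_four_block_mat[of _ n n _ m _ m _ _ n _ m])
      (auto simp: uminus_zero_mat add_uminus_minus_mat[of _ n m])
  have MS: "?M * ?S = four_block_mat (A * B) (A * B * A) B (B * A)"
    using A B by (subst mult_four_block_mat[of _ n n _ m _ m _ _ n _ m]) auto
  have SN: "?S * ?N = four_block_mat (A * B) (A * B * A) B (B * A)"
    using A B by (subst mult_four_block_mat[of _ n n _ m _ m _ _ n _ m])
      (auto simp: assoc_mult_mat[of _ n m _ n _ m])
  have C: "?M \<in> carrier_mat (n + m) (n + m)" "?N \<in> carrier_mat (n + m) (n + m)"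
    "?S \<in> carrier_mat (n + m) (n + m)" "?R \<in> carrier_mat (n + m) (n + m)"
    using A B by auto
  have "?S * ?N * ?R = ?M * (?S * ?R)"
    unfolding SN MS[symmetric] by (rule assoc_mult_mat[OF C(1,3,4)])
  hence eq: "?M = ?S * ?N * ?R"
    unfolding SR using right_mult_one_mat[OF C(1)] by simp
  hence "similar_mat ?M ?N"
    using C by (intro similar_matI[OF _ SR RS eq]) blast
  hence MN: "char_poly ?M = char_poly ?N" by (rule char_poly_similar)
  \<comment> \<open>The block rule for characteristic polynomials asks that those of the diagonal
    blocks split into linear factors.\<close>
  have lin: "\<exists>as. char_poly X = (\<Prod>a\<leftarrow>as. [:- a, 1:])" if "X \<in> carrier_mat k k"
    for X :: "complex mat" and k
    using char_poly_factorized[OF that] by blast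
  have "char_poly ?M = char_poly (A * B) * char_poly (0\<^sub>m m m)"
    using A B by (intro char_poly_0_block'[OF refl] lin[of _ n] lin[of _ m]) auto
  moreover have "char_poly ?N = char_poly (0\<^sub>m n n) * char_poly (B * A)"
    using A B by (intro char_poly_0_block'[OF refl] lin[of _ n] lin[of _ m]) auto
  ultimately have "char_poly (A * B) * [:0, 1:] ^ m = char_poly (B * A) * [:0, 1:] ^ n"
    using MN by (simp add: char_poly_zero_mat mult.commute)
  hence "proots (char_poly (A * B) * [:0, 1:] ^ m) = proots (char_poly (B * A) * [:0, 1:] ^ n)"
    by (rule arg_cong)
  moreover have "char_poly (A * B) \<noteq> 0" "char_poly (B * A) \<noteq> 0"
    using degree_monic_char_poly[of "A * B" n] degree_monic_char_poly[of "B * A" m] A B by auto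
  ultimately show ?thesis
    by (simp add: eigs_def proots_mult proots_power)
qed

section \<open>Energy and the real spectrum of a symmetric matrix\<close>

lemma sum_image_mset_multiplicity:
  fixes f :: "'b \<Rightarrow> 'a :: semiring_1"
  shows "(\<Sum>x\<in>#M. f x) = (\<Sum>x\<in>set_mset M. of_nat (count M x) * f x)"
proof (induction M)
  case (add x M)
  have "(\<Sum>y\<in>set_mset M. of_nat (count M y) * f y)
      = (\<Sum>y\<in>insert x (set_mset M). of_nat (count M y) * f y)"
    \<comment> \<open>If \<open>x\<close> is new to \<open>M\<close>, the added term has count
      0.\<close>
    by (rule sum.mono_neutral_left) (auto simp: not_in_iff)
  moreover have "(\<Sum>y\<in>insert x (set_mset M). of_nat (count (add_mset x M) y) * f y)
      = (\<Sum>y\<in>insert x (set_mset M). (if y = x then f y else 0) + of_nat (count M y) * f y)"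
    by (rule sum.cong) (auto simp: algebra_simps)
  ultimately show ?case
    using add by (simp add: sum.distrib)
qed simp

text \<open>The order of a root of the characteristic polynomial is its count in
  \<open>eigs\<close>, so the weighted sum over distinct eigenvalues is a plain multiset
  sum.\<close>

lemma mat_energy_eigs:
  assumes "M \<in> carrier_mat n n"
  shows "mat_energy M = (\<Sum>z\<in>#eigs (map_mat complex_of_real M). cmod z)"
proof -
  let ?B = "map_mat complex_of_real M"
  have B: "?B \<in> carrier_mat n n" using assms by auto
  have "char_poly ?B \<noteq> 0" using degree_monic_char_poly[OF B] by auto
  thus ?thesis
    by (simp add: mat_energy_def eigs_def sum_image_mset_multiplicity
        spectrum_root_char_poly[OF B] Let_def)
qed

text \<open>For an eigenvector \<open>v\<close>, moving the symmetric real matrix across the product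
  of \<open>v\<close> with its conjugate turns the factor \<open>z\<close> into
  \<open>cnj z\<close>; the product is nonzero and cancels.\<close>

lemma symmetric_eigenvalue_real:
  assumes A: "A \<in> carrier_mat n n" and sym: "A\<^sup>T = A"
    and e: "eigenvalue (map_mat complex_of_real A) z"
  shows "z \<in> \<real>"
proof -
  let ?A = "map_mat complex_of_real A"
  obtain v where v: "v \<in> carrier_vec n" "v \<noteq> 0\<^sub>v n" and Av: "?A *\<^sub>v v = z \<cdot>\<^sub>v v"
    using e A unfolding eigenvalue_def eigenvector_def by auto
  have cA: "?A *\<^sub>v conjugate v = conjugate (?A *\<^sub>v v)"
    using A v by (intro eq_vecI) (auto simp: scalar_prod_def)
  have tA: "?A\<^sup>T = ?A"
    using sym by (metis map_mat_transpose)
  have "z * (v \<bullet>c v) = (?A *\<^sub>v v) \<bullet>c v"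
    using v by (simp add: Av)
  also have "\<dots> = v \<bullet> (?A *\<^sub>v conjugate v)"
    using transpose_vec_mult_scalar[of ?A n n "conjugate v" v] A v tA by simp
  also have "\<dots> = cnj z * (v \<bullet>c v)"
    using v unfolding cA Av by (simp add: conjugate_smult_vec)
  finally have "z = cnj z"
    using v by simp
  thus ?thesis by (metis Reals_cnj_iff)
qed

text \<open>This links the complex multiset \<open>eigs\<close> to the real \<open>spectrum\<close>,
  in which the bound on the smallest eigenvalue is expressed.\<close>

lemma eigs_symmetric:
  assumes A: "A \<in> carrier_mat n n" and sym: "A\<^sup>T = A"
    and z: "z \<in># eigs (map_mat complex_of_real A)"
  obtains x where "z = complex_of_real x" "x \<in> spectrum A"
proof -
  let ?A = "map_mat complex_of_real A"
  have B: "?A \<in> carrier_mat n n" using A by auto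
  have "char_poly ?A \<noteq> 0" using degree_monic_char_poly[OF B] by auto
  hence root: "poly (char_poly ?A) z = 0"
    using z by (simp add: eigs_def)
  hence "eigenvalue ?A z" by (simp add: eigenvalue_root_char_poly[OF B])
  from symmetric_eigenvalue_real[OF A sym this] obtain x where x: "z = complex_of_real x"
    by (auto elim: Reals_cases)
  \<comment> \<open>The complex characteristic polynomial is the image of the real one under the
    embedding, so a real root descends.\<close>
  have "poly (char_poly A) x = 0"
    using root by (simp add: x of_real_hom.char_poly_hom[OF A] of_real_hom.poly_map_poly)
  thus ?thesis
    using that x spectrum_root_char_poly[OF A] by auto
qed

section \<open>Line graphs and complements\<close>

lemma adjacent_line_graph:
  "adjacent (line_graph G) e f \<longleftrightarrow> e \<in> edges G \<and> f \<in> edges G \<and> e \<noteq> f \<and> e \<inter> f \<noteq> {}"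
  unfolding adjacent_def line_graph_def by (auto simp: doubleton_eq_iff)

lemma verts_line_graph [simp]: "verts (line_graph G) = edges G"
  by (simp add: line_graph_def)

lemma adjacent_commute: "adjacent G u v \<longleftrightarrow> adjacent G v u"
  by (simp add: adjacent_def insert_commute)

lemma adjacent_complement_graph:
  "adjacent (complement_graph G) u v \<longleftrightarrow>
     u \<in> verts G \<and> v \<in> verts G \<and> u \<noteq> v \<and> \<not> adjacent G u v"
proof -
  \<comment> \<open>An edge determines its endpoints only up to order, so symmetry of adjacency is
    used to pass from \<open>x\<close>, \<open>y\<close> back to \<open>u\<close>,
    \<open>v\<close>.\<close>
  have "adjacent (complement_graph G) u v \<longleftrightarrow>
    (\<exists>x y. {u, v} = {x, y} \<and> x \<in> verts G \<and> y \<in> verts G \<and> x \<noteq> y \<and> \<not> adjacent G x y)"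
    by (simp add: adjacent_def[of "complement_graph G"]) (simp add: complement_graph_def)
  thus ?thesis
    using adjacent_commute[of G u v] by (auto simp: doubleton_eq_iff)
qed

lemma verts_complement_graph [simp]: "verts (complement_graph G) = verts G"
  by (simp add: complement_graph_def)

text \<open>The third vertex supplied by property (dagger) for adjacent \<open>u\<close>,
  \<open>v\<close> is a common neighbour of both in the complement, so it gives a walk of length
  2.\<close>

lemma gdist_complement_graph:
  assumes dag: "property_dagger H" and u: "u \<in> verts H" and v: "v \<in> verts H"
    and irrefl: "\<And>w. \<not> adjacent H w w"
  shows "gdist (complement_graph H) u v = (if u = v then 0 else if adjacent H u v then 2 else 1)"
proof -
  let ?R = "adj_rel (complement_graph H)"
  have R: "(x, y) \<in> ?R \<longleftrightarrow> x \<in> verts H \<and> y \<in> verts H \<and> x \<noteq> y \<and> \<not> adjacent H x y" for x y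
    by (simp add: adj_rel_def adjacent_complement_graph)
  consider "u = v" | "u \<noteq> v" "\<not> adjacent H u v" | "u \<noteq> v" "adjacent H u v" by blast
  thus ?thesis
  proof cases
    case 1
    thus ?thesis by (auto simp: gdist_def intro: Least_eq_0)
  next
    case 2
    have "gdist (complement_graph H) u v = 1"
      unfolding gdist_def
    proof (rule Least_equality)
      show "(u, v) \<in> ?R ^^ 1" using 2 u v by (simp add: R)
      show "1 \<le> n" if "(u, v) \<in> ?R ^^ n" for n
        using that 2 by (cases n) auto
    qed
    with 2 show ?thesis by simp
  next
    case 3
    then obtain w where "w \<in> verts H" "w \<noteq> u" "w \<noteq> v" "\<not> adjacent H w u" "\<not> adjacent H w v"
      using dag u v unfolding property_dagger_def by blast
    hence w: "(u, w) \<in> ?R" "(w, v) \<in> ?R"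
      using u v by (auto simp: R adjacent_commute[of H])
    have "gdist (complement_graph H) u v = 2"
      unfolding gdist_def
    proof (rule Least_equality)
      show "(u, v) \<in> ?R ^^ 2" using w by (auto simp: numeral_2_eq_2)
      show "2 \<le> n" if "(u, v) \<in> ?R ^^ n" for n
      proof (rule ccontr)
        assume "\<not> 2 \<le> n"
        hence "n = 0 \<or> n = 1" by auto
        thus False using that 3 by (auto simp: R)
      qed
    qed
    with 3 show ?thesis by simp
  qed
qed

lemma eccentricity_complement_graph:
  assumes "property_dagger H" "u \<in> verts H" "finite (verts H)"
    and "\<And>w. \<not> adjacent H w w" and "v \<in> verts H" "adjacent H u v"
  shows "eccentricity (complement_graph H) u = 2"
  unfolding eccentricity_def
proof (rule Max_eqI)
  have "gdist (complement_graph H) u v = 2"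
    using assms by (subst gdist_complement_graph) auto
  thus "2 \<in> gdist (complement_graph H) u ` verts (complement_graph H)"
    using assms by force
qed (use assms in \<open>auto simp: gdist_complement_graph\<close>)

text \<open>All eccentricities in the complement are 2, so exactly the pairs at distance 2 survive,
  and these are the adjacent pairs of \<open>H\<close>. The hypothesis \<open>nbr\<close> excludes
  isolated vertices of \<open>H\<close>, whose eccentricity in the complement would be at most
  1.\<close>

lemma eccentricity_mat_complement_graph:
  assumes dag: "property_dagger H" and fin: "finite (verts H)"
    and irrefl: "\<And>w. \<not> adjacent H w w"
    and nbr: "\<And>u. u \<in> verts H \<Longrightarrow> \<exists>v\<in>verts H. adjacent H u v"
    and es: "set es = verts H"
  shows "eccentricity_mat (complement_graph H) es = 2 \<cdot>\<^sub>m adjacency_mat H es"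
proof (rule eq_matI)
  fix i j
  assume "i < dim_row (2 \<cdot>\<^sub>m adjacency_mat H es)" "j < dim_col (2 \<cdot>\<^sub>m adjacency_mat H es)"
  hence ij: "i < length es" "j < length es" by (auto simp: adjacency_mat_def)
  have V: "es ! k \<in> verts H" if "k < length es" for k
    using that es by (metis nth_mem)
  have ecc: "eccentricity (complement_graph H) (es ! k) = 2" if "k < length es" for k
    using eccentricity_complement_graph[OF dag V[OF that] fin irrefl] nbr[OF V[OF that]] by blast
  show "eccentricity_mat (complement_graph H) es $$ (i, j) = (2 \<cdot>\<^sub>m adjacency_mat H es) $$ (i, j)"
    using ij irrefl
    by (simp add: eccentricity_mat_def adjacency_mat_def ecc gdist_complement_graph[OF dag V V irrefl])
qed (auto simp: eccentricity_mat_def adjacency_mat_def)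

section \<open>The incidence matrix\<close>

definition incidence_mat :: "'a list \<Rightarrow> 'a set list \<Rightarrow> real mat" where
  "incidence_mat vs es = mat (length vs) (length es) (\<lambda>(i, j). if vs ! i \<in> es ! j then 1 else 0)"

lemma sum_nth_distinct:
  assumes "distinct xs"
  shows "(\<Sum>i<length xs. f (xs ! i)) = sum f (set xs)"
  using sum.reindex_bij_betw[OF bij_betw_nth[OF assms refl refl], of f] by simp

text \<open>The entry at edges \<open>e\<close>, \<open>f\<close> counts their common endpoints: 2
  if they coincide, 1 if they are distinct and meet, 0 otherwise.\<close>

lemma incidence_mat_gram:
  assumes sg: "simple_graph G" and vs: "vertex_labelling G vs"
    and es: "distinct es" "set es = edges G"
  shows "(incidence_mat vs es)\<^sup>T * incidence_mat vs es
    = adjacency_mat (line_graph G) es + 2 \<cdot>\<^sub>m 1\<^sub>m (length es)"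
proof (rule eq_matI)
  fix i j
  assume "i < dim_row (adjacency_mat (line_graph G) es + 2 \<cdot>\<^sub>m 1\<^sub>m (length es))"
    "j < dim_col (adjacency_mat (line_graph G) es + 2 \<cdot>\<^sub>m 1\<^sub>m (length es))"
  hence ij: "i < length es" "j < length es" by (auto simp: adjacency_mat_def)
  let ?e = "es ! i" and ?f = "es ! j"
  have ef: "?e \<in> edges G" "?f \<in> edges G" using ij es by (metis nth_mem)+
  have sub: "?e \<subseteq> verts G" "card ?e = 2" "?f \<subseteq> verts G" "card ?f = 2" and fin: "finite (verts G)"
    using ef sg by (auto simp: simple_graph_def)
  have fe: "finite ?e" "finite ?f" using sub by (auto intro: card_ge_0_finite)
  have "((incidence_mat vs es)\<^sup>T * incidence_mat vs es) $$ (i, j)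
      = (\<Sum>k<length vs. if vs ! k \<in> ?e \<and> vs ! k \<in> ?f then 1 else 0)"
    using ij by (auto simp: incidence_mat_def scalar_prod_def atLeast0LessThan intro!: sum.cong)
  also have "\<dots> = (\<Sum>v\<in>verts G. if v \<in> ?e \<and> v \<in> ?f then 1 else 0)"
    using vs sum_nth_distinct[of vs "\<lambda>v. if v \<in> ?e \<and> v \<in> ?f then 1 else (0::real)"]
    by (simp add: vertex_labelling_def)
  also have "\<dots> = real (card {v \<in> verts G. v \<in> ?e \<and> v \<in> ?f})"
    using fin by (simp add: sum.If_cases Int_def)
  also have "{v \<in> verts G. v \<in> ?e \<and> v \<in> ?f} = ?e \<inter> ?f" using sub by auto
  finally have eq: "((incidence_mat vs es)\<^sup>T * incidence_mat vs es) $$ (i, j)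
    = real (card (?e \<inter> ?f))" .
  \<comment> \<open>Two 2-element sets with two common elements would be equal.\<close>
  have "card (?e \<inter> ?f) = 1" if "?e \<noteq> ?f" "?e \<inter> ?f \<noteq> {}"
  proof -
    have "card (?e \<inter> ?f) \<noteq> 0" using that fe by auto
    moreover have "card (?e \<inter> ?f) < 2"
    proof (rule ccontr)
      assume "\<not> card (?e \<inter> ?f) < 2"
      hence "?e \<inter> ?f = ?e" "?e \<inter> ?f = ?f"
        using card_seteq[of ?e "?e \<inter> ?f"] card_seteq[of ?f "?e \<inter> ?f"] fe sub by auto
      thus False using that by simp
    qed
    ultimately show ?thesis by simp
  qed
  moreover have "?e = ?f \<longleftrightarrow> i = j" using ij es nth_eq_iff_index_eq by blast
  ultimately show "((incidence_mat vs es)\<^sup>T * incidence_mat vs es) $$ (i, j)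
    = (adjacency_mat (line_graph G) es + 2 \<cdot>\<^sub>m 1\<^sub>m (length es)) $$ (i, j)"
    unfolding eq using ij ef sub
    by (auto simp: adjacency_mat_def adjacent_line_graph)
qed (auto simp: incidence_mat_def adjacency_mat_def)

lemma card_incident_edges:
  assumes sg: "simple_graph G"
  shows "card {e \<in> edges G. v \<in> e} = card {u \<in> verts G. adjacent G v u}"
proof (rule bij_betw_same_card[symmetric])
  show "bij_betw (\<lambda>u. {v, u}) {u \<in> verts G. adjacent G v u} {e \<in> edges G. v \<in> e}"
    unfolding bij_betw_def
  proof
    show "inj_on (\<lambda>u. {v, u}) {u \<in> verts G. adjacent G v u}"
      by (auto simp: inj_on_def doubleton_eq_iff)
    have "e \<in> (\<lambda>u. {v, u}) ` {u \<in> verts G. adjacent G v u}" if "e \<in> edges G" "v \<in> e" for e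
    proof -
      have "card e = 2" "e \<subseteq> verts G" using that sg by (auto simp: simple_graph_def)
      then obtain x y where "e = {x, y}" by (auto simp: card_2_iff)
      with that have "e = {v, y} \<or> e = {v, x}" by auto
      then obtain u where "e = {v, u}" by blast
      thus ?thesis using that \<open>e \<subseteq> verts G\<close> by (auto simp: adjacent_def)
    qed
    thus "(\<lambda>u. {v, u}) ` {u \<in> verts G. adjacent G v u} = {e \<in> edges G. v \<in> e}"
      by (auto simp: adjacent_def)
  qed
qed

text \<open>The entry at vertices \<open>u\<close>, \<open>v\<close> counts the edges containing
  both: the degree \<open>r\<close> on the diagonal, and off it 1 or 0, as only the edge {u, v} can
  qualify.\<close>

lemma incidence_mat_gram_transpose:
  assumes sg: "simple_graph G" and reg: "regular_graph G r" and vs: "vertex_labelling G vs"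
    and es: "distinct es" "set es = edges G"
  shows "incidence_mat vs es * (incidence_mat vs es)\<^sup>T
    = adjacency_mat G vs + real r \<cdot>\<^sub>m 1\<^sub>m (length vs)"
proof (rule eq_matI)
  fix i j
  assume "i < dim_row (adjacency_mat G vs + real r \<cdot>\<^sub>m 1\<^sub>m (length vs))"
    "j < dim_col (adjacency_mat G vs + real r \<cdot>\<^sub>m 1\<^sub>m (length vs))"
  hence ij: "i < length vs" "j < length vs" by (auto simp: adjacency_mat_def)
  let ?u = "vs ! i" and ?v = "vs ! j"
  have uv: "?u \<in> verts G" "?v \<in> verts G" "?u = ?v \<longleftrightarrow> i = j"
    using ij vs unfolding vertex_labelling_def
    by (metis nth_mem, metis nth_mem, metis nth_eq_iff_index_eq)
  have fin: "finite (edges G)" using es by (metis finite_set)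
  have irrefl: "\<not> adjacent G ?u ?u"
    using sg by (force simp: simple_graph_def adjacent_def)
  have "(incidence_mat vs es * (incidence_mat vs es)\<^sup>T) $$ (i, j)
      = (\<Sum>k<length es. if ?u \<in> es ! k \<and> ?v \<in> es ! k then 1 else 0)"
    using ij by (auto simp: incidence_mat_def scalar_prod_def atLeast0LessThan intro!: sum.cong)
  also have "\<dots> = (\<Sum>e\<in>edges G. if ?u \<in> e \<and> ?v \<in> e then 1 else 0)"
    using es sum_nth_distinct[of es "\<lambda>e. if ?u \<in> e \<and> ?v \<in> e then 1 else (0::real)"] by simp
  also have "\<dots> = real (card {e \<in> edges G. ?u \<in> e \<and> ?v \<in> e})"
    using fin by (simp add: sum.If_cases Int_def)
  finally have eq: "(incidence_mat vs es * (incidence_mat vs es)\<^sup>T) $$ (i, j)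
    = real (card {e \<in> edges G. ?u \<in> e \<and> ?v \<in> e})" .
  show "(incidence_mat vs es * (incidence_mat vs es)\<^sup>T) $$ (i, j)
    = (adjacency_mat G vs + real r \<cdot>\<^sub>m 1\<^sub>m (length vs)) $$ (i, j)"
  proof (cases "i = j")
    case True
    have "card {e \<in> edges G. ?u \<in> e} = r"
      using card_incident_edges[OF sg] reg uv by (simp add: regular_graph_def)
    thus ?thesis unfolding eq using True ij irrefl by (simp add: adjacency_mat_def)
  next
    case False
    have "e = {?u, ?v}" if "e \<in> edges G" "?u \<in> e" "?v \<in> e" for e
      using that sg uv False by (auto simp: simple_graph_def card_2_iff)
    hence "{e \<in> edges G. ?u \<in> e \<and> ?v \<in> e} = edges G \<inter> {{?u, ?v}}"
      by blast
    hence "{e \<in> edges G. ?u \<in> e \<and> ?v \<in> e} = (if adjacent G ?u ?v then {{?u, ?v}} else {})"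
      unfolding adjacent_def by simp
    thus ?thesis unfolding eq using False ij by (simp add: adjacency_mat_def)
  qed
qed (auto simp: incidence_mat_def adjacency_mat_def)

text \<open>Incident vertex-edge pairs are counted by vertex, \<open>r\<close> each, and by edge, 2
  each.\<close>

lemma handshake_regular:
  assumes sg: "simple_graph G" and reg: "regular_graph G r" and fin: "finite (edges G)"
  shows "2 * card (edges G) = card (verts G) * r"
proof -
  have fv: "finite (verts G)" using sg by (simp add: simple_graph_def)
  have c: "{v \<in> verts G. v \<in> e} = e" "card e = 2" if "e \<in> edges G" for e
    using sg that by (auto simp: simple_graph_def)
  have "card (verts G) * r = (\<Sum>v\<in>verts G. card {e \<in> edges G. v \<in> e})"
    using reg card_incident_edges[OF sg] by (simp add: regular_graph_def)
  also have "\<dots> = (\<Sum>e\<in>edges G. card {v \<in> verts G. v \<in> e})"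
    using sum_multicount_gen[of "verts G" "edges G" "\<lambda>v e. v \<in> e"
        "\<lambda>e. card {v \<in> verts G. v \<in> e}"] fv fin by simp
  also have "\<dots> = 2 * card (edges G)"
    using c by simp
  finally show ?thesis by simp
qed

text \<open>An endpoint of \<open>e\<close> lies on at least two edges, so some edge other than
  \<open>e\<close> shares it.\<close>

lemma line_graph_neighbour:
  assumes sg: "simple_graph G" and reg: "regular_graph G r" and "2 \<le> r" and e: "e \<in> edges G"
  shows "\<exists>f\<in>edges G. adjacent (line_graph G) e f"
proof -
  from e sg have "card e = 2" "e \<subseteq> verts G" by (auto simp: simple_graph_def)
  then obtain v where v: "v \<in> e" "v \<in> verts G" by (auto simp: card_2_iff)
  have "card {f \<in> edges G. v \<in> f} \<ge> 2"
    using card_incident_edges[OF sg] reg v \<open>2 \<le> r\<close> by (simp add: regular_graph_def)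
  hence "\<not> {f \<in> edges G. v \<in> f} \<subseteq> {e}"
    using card_mono[of "{e}" "{f \<in> edges G. v \<in> f}"] by auto
  thus ?thesis using v e by (auto simp: adjacent_line_graph)
qed

section \<open>The energy of the complement of the line graph\<close>

theorem theorem3p25:
  fixes G :: "'a sgraph" and r p :: nat and vs :: "'a list" and es :: "'a set list"
  assumes "simple_graph G"
    and "connected_graph G"
    and "regular_graph G r"
    and "card (verts G) = p"
    and "vertex_labelling G vs"
    and "vertex_labelling (complement_graph (line_graph G)) es"
    and "smallest_eigenvalue (adjacency_mat G vs) \<ge> 2 - real r"
    and "property_dagger (line_graph G)"
  shows "eccentricity_energy (complement_graph (line_graph G)) es = 4 * real p * (real r - 2)"
proof -
  note sg = assms(1) and reg = assms(3) and vs = assms(5)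
  have es: "distinct es" "set es = edges G"
    using assms(6) by (auto simp: vertex_labelling_def)
  have fin: "finite (edges G)" using es by (metis finite_set)
  define m where "m = length es"
  have m: "card (edges G) = m" using es distinct_card m_def by metis
  have p: "length vs = p" using vs assms(4) distinct_card by (force simp: vertex_labelling_def)
  have "p > 0"
    using assms(1,2,4) by (auto simp: connected_graph_def simple_graph_def card_gt_0_iff)
  let ?cm = "map_mat complex_of_real"
  define A where "A = adjacency_mat G vs"
  define L where "L = adjacency_mat (line_graph G) es"
  define B where "B = incidence_mat vs es"
  have A: "A \<in> carrier_mat p p" by (simp add: A_def adjacency_mat_def p)
  have L: "L \<in> carrier_mat m m" by (simp add: L_def adjacency_mat_def m_def)
  have B: "B \<in> carrier_mat p m" by (simp add: B_def incidence_mat_def m_def p)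
  have symA: "A\<^sup>T = A"
    by (rule eq_matI) (auto simp: A_def adjacency_mat_def adjacent_commute)
  have eig_ge: "\<exists>x. z = complex_of_real x \<and> x \<ge> 2 - real r" if z: "z \<in># eigs (?cm A)" for z
  proof -
    obtain x where x: "z = complex_of_real x" "x \<in> spectrum A"
      by (rule eigs_symmetric[OF A symA z])
    \<comment> \<open>Finiteness of the spectrum makes \<open>Min\<close> a genuine lower
      bound.\<close>
    have "Min (spectrum A) \<le> x"
      using card_finite_spectrum[OF A] x by simp
    thus ?thesis using assms(7) x by (auto simp: smallest_eigenvalue_def A_def)
  qed
  have "\<not> adjacent G v v" for v
    using sg by (force simp: simple_graph_def adjacent_def)
  hence "trace_mat (?cm A) = 0"
    by (simp add: trace_mat_def A_def adjacency_mat_def)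
  hence sum0: "sum_mset (eigs (?cm A)) = 0"
    using sum_eigs[of "?cm A" p] A by simp
  have re_sum: "(\<Sum>z\<in>#M. Re z) = Re (sum_mset M)" for M
    by (induction M) auto
  have card_eigs: "size (eigs (?cm A)) = p" using A by (intro size_eigs) auto

  have "2 \<le> r"
  proof -
    \<comment> \<open>Each of the \<open>p\<close> eigenvalues is at least \<open>2 - r\<close>,
      while their sum is the trace 0.\<close>
    have "(\<Sum>z\<in>#eigs (?cm A). 2 - real r) \<le> (\<Sum>z\<in>#eigs (?cm A). Re z)"
      using eig_ge by (intro sum_mset_mono) fastforce
    hence "real p * (2 - real r) \<le> 0"
      by (simp add: re_sum sum0 card_eigs)
    with \<open>p > 0\<close> show ?thesis by (simp add: mult_le_0_iff)
  qed

  have irreflL: "\<not> adjacent (line_graph G) w w" for w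
    by (simp add: adjacent_line_graph)
  have ecc: "eccentricity_mat (complement_graph (line_graph G)) es = 2 \<cdot>\<^sub>m L"
    unfolding L_def
    using line_graph_neighbour[OF sg reg \<open>2 \<le> r\<close>] irreflL es fin assms(8)
    by (intro eccentricity_mat_complement_graph) auto

  define N where "N = ?cm B * ?cm B\<^sup>T"
  define K where "K = ?cm B\<^sup>T * ?cm B"
  have N: "N \<in> carrier_mat p p" and K: "K \<in> carrier_mat m m"
    using B by (auto simp: N_def K_def)
  have "N = ?cm (B * B\<^sup>T)"
    using B unfolding N_def by (intro of_real_hom.mat_hom_mult[symmetric]) auto
  \<comment> \<open>The factor 1 matches the affine form required by
    \<open>eigs_affine\<close>.\<close>
  also have "\<dots> = 1 \<cdot>\<^sub>m ?cm A + of_nat r \<cdot>\<^sub>m 1\<^sub>m p"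
    unfolding B_def incidence_mat_gram_transpose[OF sg reg vs es] using A
    by (intro eq_matI) (auto simp: A_def p)
  finally have "eigs N = image_mset (\<lambda>a. 1 * a + of_nat r) (eigs (?cm A))"
    using A eigs_affine[of "?cm A" p 1 "of_nat r"] by simp
  hence eN: "eigs N = image_mset (\<lambda>a. a + of_nat r) (eigs (?cm A))" by simp
  have "K = ?cm (B\<^sup>T * B)"
    using B unfolding K_def by (intro of_real_hom.mat_hom_mult[symmetric]) auto
  also have "\<dots> = ?cm (L + 2 \<cdot>\<^sub>m 1\<^sub>m m)"
    unfolding B_def incidence_mat_gram[OF sg vs es] by (simp add: L_def m_def)
  finally have "?cm (2 \<cdot>\<^sub>m L) = 2 \<cdot>\<^sub>m K + (-4) \<cdot>\<^sub>m 1\<^sub>m m"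
    using L by (intro eq_matI) auto
  hence eL: "eigs (?cm (2 \<cdot>\<^sub>m L)) = image_mset (\<lambda>a. 2 * a + (-4)) (eigs K)"
    using eigs_affine[OF K] by simp

  \<comment> \<open>\<open>?h\<close> sends an eigenvalue of \<open>K\<close> to the modulus of the
    corresponding eigenvalue of \<open>2 L\<close>. Its value at 0 is 4, so the padding zeros
    contribute \<open>4 m\<close> and \<open>4 p\<close>.\<close>
  let ?h = "\<lambda>z. cmod (2 * z + (-4))"
  have "eigs N + replicate_mset m 0 = eigs K + replicate_mset p 0"
    using B unfolding N_def K_def by (intro eigs_mult_comm) auto
  hence "(\<Sum>z\<in>#eigs N + replicate_mset m 0. ?h z) = (\<Sum>z\<in>#eigs K + replicate_mset p 0. ?h z)"
    by simp
  hence KN: "(\<Sum>z\<in>#eigs K. ?h z) = (\<Sum>z\<in>#eigs N. ?h z) + 4 * real m - 4 * real p"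
    by simp
  \<comment> \<open>The bound \<open>x \<ge> 2 - r\<close> is exactly what makes
    \<open>2 x + 2 r - 4\<close> nonnegative, so the modulus is linear in the eigenvalue and the
    trace can be used.\<close>
  have "?h (z + of_nat r) = 2 * Re z + (2 * real r - 4)" if z: "z \<in># eigs (?cm A)" for z
  proof -
    obtain x where x: "z = complex_of_real x" "x \<ge> 2 - real r" using eig_ge[OF z] by blast
    have "2 * (z + of_nat r) + (-4) = complex_of_real (2 * x + 2 * real r - 4)"
      by (simp add: x)
    hence "?h (z + of_nat r) = \<bar>2 * x + 2 * real r - 4\<bar>"
      by (simp only: norm_of_real)
    thus ?thesis using x by simp
  qed
  hence "(\<Sum>z\<in>#eigs N. ?h z) = (\<Sum>z\<in>#eigs (?cm A). 2 * Re z + (2 * real r - 4))"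
    unfolding eN by (simp add: image_mset.compositionality o_def cong: image_mset_cong)
  also have "\<dots> = 2 * (\<Sum>z\<in>#eigs (?cm A). Re z) + real p * (2 * real r - 4)"
    by (simp add: sum_mset.distrib sum_mset_distrib_left card_eigs
        image_mset.compositionality o_def)
  also have "\<dots> = real p * (2 * real r - 4)"
    by (simp add: re_sum sum0)
  finally have sN: "(\<Sum>z\<in>#eigs N. ?h z) = real p * (2 * real r - 4)" .

  have "2 * m = p * r"
    using handshake_regular[OF sg reg fin] m assms(4) by simp
  hence hs: "2 * real m = real p * real r"
    by (metis of_nat_mult of_nat_numeral)
  have "eccentricity_energy (complement_graph (line_graph G)) es = (\<Sum>z\<in>#eigs K. ?h z)"
    using L mat_energy_eigs[of "2 \<cdot>\<^sub>m L" m]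
    by (simp add: eccentricity_energy_def ecc eL image_mset.compositionality o_def)
  \<comment> \<open>With \<open>4 m = 2 p r\<close>, the sum \<open>p (2 r - 4) + 4 m - 4 p\<close>
    collapses to the claimed value.\<close>
  also have "\<dots> = 4 * real p * (real r - 2)"
    unfolding KN sN using hs by (simp add: algebra_simps)
  finally show ?thesis .
qed

end
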